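(* A Banach action $A\times X\to Y$ preserves unconditional convergence if and only if it is unconditional.
   Context: All Banach spaces are over the field $\mathbb F$ of real or complex numbers; $\omega=\{0,1,2,\dots\}$, $\mathbb N=\omega\setminus\{0\}$, and each $n\in\omega$ is identified with the set $\{0,\dots,n-1\}$. A Banach action is a continuous bilinear function $A\times X\to Y$, $(a,x)\mapsto ax$, where $A,X,Y$ are Banach spaces (over the same field $\mathbb F$). A series $\sum_{n\in\omega}x_n$ in a Banach space $X$ converges unconditionally if for every permutation $\sigma$ of $\omega$ the series $\sum_{n\in\omega}x_{\sigma(n)}$ converges in $X$. A Banach action $A\times X\to Y$ preserves unconditional convergence if for every unconditionally convergent series $\sum_{n\in\omega}x_n$ in $X$ and every bounded sequence $(a_n)_{n\in\omega}$ in $A$ the series $\sum_{n\in\omega}a_nx_n$ converges unconditionally in $Y$. A Banach action $A\times X\to Y$ is called unconditional if there exists a positive real number $C$ such that for every $n\in\mathbb N$ and all sequences $(a_k)_{k\in n}$ in $A$ and $(x_k)_{k\in n}$ in $X$ we have $$\Big\|\sum_{k\in n}a_kx_k\Big\|_Y\le C\cdot\max_{k\in n}\|a_k\|_A\cdot\max_{F\subseteq n}\Big\|\sum_{k\in F}x_k\Big\|_X.$$ *)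

theory Defs
  imports "HOL-Analysis.Analysis"
begin

text \<open>
  The scalar field is a type of class \<open>real_normed_field\<close>, with instances \<open>real\<close> and \<open>complex\<close>.
  The norm of this class is multiplicative, so by Mazur's theorem these are, up to isometric
  isomorphism, the only scalar fields covered. The class \<open>banach\<close> provides
  the norm, completeness and real scaling; \<open>scale_of_real\<close> says that the latter
  is the restriction of the given scalar multiplication.
\<close>

locale banach_space_over = vector_space scale
  for scale :: "'f::real_normed_field \<Rightarrow> 'a::banach \<Rightarrow> 'a" +
  assumes norm_scale: "norm (scale c x) = norm c * norm x"
    and scale_of_real: "scale (of_real r) x = r *\<^sub>R x"

lemma banach_space_over_real: "banach_space_over ((*\<^sub>R) :: real \<Rightarrow> 'a::banach \<Rightarrow> 'a)"
  by unfold_locales (auto simp: algebra_simps)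

lemma banach_space_over_complex: "banach_space_over ((*) :: complex \<Rightarrow> complex \<Rightarrow> complex)"
  by unfold_locales (auto simp: algebra_simps norm_mult scaleR_conv_of_real)

locale banach_action =
  A: banach_space_over scaleA + X: banach_space_over scaleX + Y: banach_space_over scaleY
  for scaleA :: "'f::real_normed_field \<Rightarrow> 'a::banach \<Rightarrow> 'a"
    and scaleX :: "'f \<Rightarrow> 'x::banach \<Rightarrow> 'x"
    and scaleY :: "'f \<Rightarrow> 'y::banach \<Rightarrow> 'y" +
  fixes act :: "'a \<Rightarrow> 'x \<Rightarrow> 'y"
  assumes linear_left: "Vector_Spaces.linear scaleA scaleY (\<lambda>a. act a x)"
    and linear_right: "Vector_Spaces.linear scaleX scaleY (\<lambda>x. act a x)"
    and continuous_act: "continuous_on UNIV (\<lambda>(a, x). act a x)"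

definition unconditionally_convergent :: "(nat \<Rightarrow> 'a::real_normed_vector) \<Rightarrow> bool" where
  "unconditionally_convergent x \<longleftrightarrow> (\<forall>\<sigma>::nat \<Rightarrow> nat. bij \<sigma> \<longrightarrow> summable (\<lambda>n. x (\<sigma> n)))"

definition preserves_unconditional_convergence ::
  "('a::real_normed_vector \<Rightarrow> 'x::real_normed_vector \<Rightarrow> 'y::real_normed_vector) \<Rightarrow> bool" where
  "preserves_unconditional_convergence act \<longleftrightarrow>
    (\<forall>x a. unconditionally_convergent x \<longrightarrow> bounded (range a) \<longrightarrow>
      unconditionally_convergent (\<lambda>n. act (a n) (x n)))"

text \<open>Finite sequences of length \<open>n\<close> are represented by functions on \<open>nat\<close>
  of which only the values below \<open>n\<close> are used.\<close>

definition unconditional_action ::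
  "('a::real_normed_vector \<Rightarrow> 'x::real_normed_vector \<Rightarrow> 'y::real_normed_vector) \<Rightarrow> bool" where
  "unconditional_action act \<longleftrightarrow>
    (\<exists>C>0. \<forall>n\<ge>1. \<forall>(a :: nat \<Rightarrow> 'a) (x :: nat \<Rightarrow> 'x).
      norm (\<Sum>k<n. act (a k) (x k))
        \<le> C * (MAX k\<in>{..<n}. norm (a k)) * (MAX F\<in>Pow {..<n}. norm (\<Sum>k\<in>F. x k)))"

end

theory Submission
  imports Defs "HOL-Combinatorics.Permutations"
begin

text \<open>
  Unconditional convergence is summability over the directed set of finite subsets of the index
  set, as introduced in \<^theory>\<open>HOL-Analysis.Infinite_Sum\<close>
  (\<open>unconditionally_convergent_iff_summable_on\<close>). The Cauchy criterion
  (\<open>summable_on_iff_Cauchy\<close>) thus reduces everything to sums over finite sets of indices that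
  avoid a given finite set.

  If the action is unconditional, the defining inequality, applied to the terms \<open>x k\<close> with
  \<open>k \<in> F\<close> and to zeros elsewhere, bounds the norm of \<open>\<Sum>k\<in>F. act (a k) (x k)\<close> by a constant times
  the largest norm of a sum of \<open>x\<close> over a subset of \<open>F\<close>. Hence the Cauchy criterion passes from
  \<open>x\<close> to the images.

  If the action is not unconditional, then for every \<open>k\<close> the inequality fails with \<open>C = 2 ^ k\<close>.
  Rescaling a violating pair gives a block of finitely many \<open>a\<close>'s of norm at most 1 and of
  \<open>x\<close>'s all of whose partial sums have norm at most \<open>(1/2) ^ k\<close>, while the sum of the images has
  norm at least 1 (\<open>not_unconditional_action_block\<close>). Since \<open>\<Sum>k. (1/2) ^ k\<close> converges, all
  blocks together form an unconditionally convergent series in \<open>X\<close>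
  (\<open>summable_on_blocks\<close>), but the series of images violates the Cauchy criterion. The blocks
  are indexed by pairs (block, position), and because the order of the terms does not matter, the
  pairing function may turn this doubly indexed family into a sequence.
\<close>

section \<open>Unconditional convergence as summability over finite sets\<close>

lemma summable_on_iff_Cauchy:
  fixes f :: "'i \<Rightarrow> 'b::banach"
  shows "f summable_on UNIV \<longleftrightarrow>
    (\<forall>e>0. \<exists>X. finite X \<and> (\<forall>F. finite F \<longrightarrow> F \<inter> X = {} \<longrightarrow> norm (sum f F) < e))"
    (is "_ \<longleftrightarrow> ?Cauchy")
proof
  assume "f summable_on UNIV"
  then obtain L where L: "(sum f \<longlongrightarrow> L) (finite_subsets_at_top UNIV)"
    by (auto simp: summable_on_def has_sum_def)
  show ?Cauchy
  proof (intro allI impI)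
    fix e :: real assume "e > 0"
    then have "\<forall>\<^sub>F F in finite_subsets_at_top UNIV. dist (sum f F) L < e/2"
      using L by (intro tendstoD) auto
    then obtain X where X: "finite X" "\<And>Z. finite Z \<Longrightarrow> X \<subseteq> Z \<Longrightarrow> dist (sum f Z) L < e/2"
      by (auto simp: eventually_finite_subsets_at_top)
    have "norm (sum f F) < e" if "finite F" "F \<inter> X = {}" for F
    proof -
      have "sum f (X \<union> F) = sum f X + sum f F"
        using that X(1) by (intro sum.union_disjoint) auto
      then have "norm (sum f F) = dist (sum f (X \<union> F)) (sum f X)"
        by (simp add: dist_norm)
      also have "\<dots> < e"
        by (rule dist_triangle_half_l[of _ L]) (use X that in auto)
      finally show ?thesis .
    qed
    with X(1) show "\<exists>X. finite X \<and> (\<forall>F. finite F \<longrightarrow> F \<inter> X = {} \<longrightarrow> norm (sum f F) < e)"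
      by blast
  qed
next
  assume Cauchy: ?Cauchy
  have "cauchy_filter (filtermap (sum f) (finite_subsets_at_top UNIV))"
    unfolding cauchy_filter_metric_filtermap
  proof (intro allI impI)
    fix e :: real assume "e > 0"
    then obtain X where X: "finite X"
      "\<And>F. finite F \<Longrightarrow> F \<inter> X = {} \<Longrightarrow> norm (sum f F) < e/2"
      using Cauchy half_gt_zero by meson
    have near: "dist (sum f F) (sum f X) < e/2" if "finite F" "X \<subseteq> F" for F
    proof -
      have "sum f (F - X) = sum f F - sum f X"
        using that by (intro sum_diff) auto
      then show ?thesis
        using X(2)[of "F - X"] that by (auto simp: dist_norm)
    qed
    have "\<forall>\<^sub>F F in finite_subsets_at_top UNIV. finite F \<and> X \<subseteq> F"
      using X(1) by (auto simp: eventually_finite_subsets_at_top)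
    moreover have "dist (sum f F) (sum f G) < e"
      if "finite F \<and> X \<subseteq> F" "finite G \<and> X \<subseteq> G" for F G
      by (rule dist_triangle_half_l[of _ "sum f X"]) (use near that in auto)
    ultimately show "\<exists>P. eventually P (finite_subsets_at_top UNIV) \<and>
        (\<forall>F G. P F \<and> P G \<longrightarrow> dist (sum f F) (sum f G) < e)"
      by blast
  qed
  moreover have "complete (UNIV :: 'b set)"
    by (meson Cauchy_convergent UNIV_I complete_def convergent_def)
  ultimately obtain L where "(sum f \<longlongrightarrow> L) (finite_subsets_at_top UNIV)"
    using complete_uniform[where S="UNIV :: 'b set"] by (force simp: filterlim_def)
  then show "f summable_on UNIV"
    by (auto simp: summable_on_def has_sum_def)
qed

lemma permutes_interval_moving_set_to_front:
  fixes F :: "nat set"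
  assumes F: "F \<subseteq> {s..<t}"
  obtains p where "p permutes {s..<t}" "p ` {s..<s + card F} = F"
proof -
  let ?I = "{s..<t}" and ?A = "{s..<s + card F}"
  have fin: "finite F"
    using F by (rule finite_subset) simp
  have "card F \<le> t - s"
    using card_mono[OF _ F] by simp
  then have A: "?A \<subseteq> ?I"
    by (cases "card F = 0") auto
  obtain g where g: "bij_betw g ?A F"
    using finite_same_card_bij[of ?A F] fin by auto
  have "card (?I - ?A) = card (?I - F)"
    using A F fin by (simp add: card_Diff_subset)
  then obtain h where h: "bij_betw h (?I - ?A) (?I - F)"
    using finite_same_card_bij[of "?I - ?A" "?I - F"] by auto
  define p where "p = (\<lambda>n. if n \<in> ?A then g n else if n \<in> ?I then h n else n)"
  have "bij_betw p ?A F"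
    using g by (subst bij_betw_cong[of _ _ g]) (auto simp: p_def)
  moreover have "bij_betw p (?I - ?A) (?I - F)"
    using h by (subst bij_betw_cong[of _ _ h]) (auto simp: p_def)
  ultimately have "bij_betw p (?A \<union> (?I - ?A)) (F \<union> (?I - F))"
    by (rule bij_betw_combine) auto
  moreover have "?A \<union> (?I - ?A) = ?I" "F \<union> (?I - F) = ?I"
    using A F by blast+
  ultimately have "bij_betw p ?I ?I"
    by simp
  then have "p permutes ?I"
    using A by (intro bij_imp_permutes) (auto simp: p_def)
  moreover have "p ` ?A = F"
    using \<open>bij_betw p ?A F\<close> by (simp add: bij_betw_def)
  ultimately show thesis
    by (rule that)
qed

text \<open>
  The consecutive intervals \<open>{m k..<m (Suc k)}\<close> partition the naturals, so permutations of the
  single intervals glue to a permutation of the naturals.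
\<close>

lemma bij_glue_interval_permutations:
  fixes m :: "nat \<Rightarrow> nat"
  assumes m: "strict_mono m" "m 0 = 0"
    and p: "\<And>k. p k permutes {m k..<m (Suc k)}"
  obtains \<sigma> where "bij \<sigma>" "\<And>k n. n \<in> {m k..<m (Suc k)} \<Longrightarrow> \<sigma> n = p k n"
proof -
  have uniq: "j = k" if "n \<in> {m j..<m (Suc j)}" "n \<in> {m k..<m (Suc k)}" for j k n
  proof -
    have "m j < m (Suc k)" "m k < m (Suc j)"
      using that by auto
    then show ?thesis
      using m(1) by (auto simp: strict_mono_less)
  qed
  have ex: "\<exists>k. n \<in> {m k..<m (Suc k)}" for n
  proof -
    define j where "j = (LEAST j. n < m j)"
    have "n < m (Suc n)"
      using seq_suble[OF m(1), of "Suc n"] by simp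
    then have j: "n < m j"
      unfolding j_def by (rule LeastI)
    with m(2) obtain k where k: "j = Suc k"
      by (cases j) auto
    have "\<not> n < m k"
      using not_less_Least[of k "\<lambda>j. n < m j"] k by (simp add: j_def)
    with j k have "n \<in> {m k..<m (Suc k)}"
      by simp
    then show ?thesis ..
  qed
  define b where "b n = (THE k. n \<in> {m k..<m (Suc k)})" for n
  have b_eq: "b n = k" if "n \<in> {m k..<m (Suc k)}" for n k
    unfolding b_def using that uniq by (intro the_equality) blast+
  have b: "n \<in> {m (b n)..<m (Suc (b n))}" for n
    using ex b_eq by metis
  define \<sigma> where "\<sigma> n = p (b n) n" for n
  define \<tau> where "\<tau> n = inv (p (b n)) n" for n
  have "b (\<sigma> n) = b n" for n
    using b permutes_in_image[OF p] by (intro b_eq) (auto simp: \<sigma>_def)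
  moreover have "b (\<tau> n) = b n" for n
    using b permutes_in_image[OF permutes_inv[OF p]] by (intro b_eq) (auto simp: \<tau>_def)
  ultimately have "\<tau> (\<sigma> n) = n" "\<sigma> (\<tau> n) = n" for n
    using permutes_inverses[OF p] by (simp_all add: \<sigma>_def \<tau>_def)
  then have "bij \<sigma>"
    by (intro o_bij[of \<tau>]) auto
  moreover have "\<sigma> n = p k n" if "n \<in> {m k..<m (Suc k)}" for k n
    using b_eq[OF that] by (simp add: \<sigma>_def)
  ultimately show thesis
    by (rule that)
qed

text \<open>
  If the Cauchy criterion for finite sets fails for some \<open>e\<close>, there are consecutive intervals of
  indices each containing a set with sum of norm at least \<open>e\<close>. A permutation that moves these sets
  to the front of their intervals makes them consecutive terms of the rearranged series, which
  therefore diverges.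
\<close>

lemma unconditionally_convergent_iff_summable_on:
  fixes x :: "nat \<Rightarrow> 'b::banach"
  shows "unconditionally_convergent x \<longleftrightarrow> x summable_on UNIV"
proof
  assume "x summable_on UNIV"
  then show "unconditionally_convergent x"
    unfolding unconditionally_convergent_def
    by (auto intro!: summable_on_imp_summable simp: summable_on_reindex_bij_betw)
next
  assume uc: "unconditionally_convergent x"
  show "x summable_on UNIV"
  proof (rule ccontr)
    assume "\<not> x summable_on UNIV"
    then obtain e where e: "e > 0"
      and far: "\<And>X. finite X \<Longrightarrow> \<exists>F. finite F \<and> F \<inter> X = {} \<and> norm (sum x F) \<ge> e"
      unfolding summable_on_iff_Cauchy by (metis not_less)
    have "\<exists>t>s. \<exists>F\<subseteq>{s..<t}. norm (sum x F) \<ge> e" for s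
    proof -
      obtain F where F: "finite F" "F \<inter> {..<s} = {}" "norm (sum x F) \<ge> e"
        using far[of "{..<s}"] by auto
      obtain t where t: "\<forall>n\<in>F. n < t"
        using F(1) finite_nat_set_iff_bounded by blast
      have "F \<subseteq> {s..<max t (Suc s)}"
      proof
        fix n assume "n \<in> F"
        then have "n \<notin> {..<s}" "n < t"
          using F(2) t by auto
        then show "n \<in> {s..<max t (Suc s)}"
          by auto
      qed
      then show ?thesis
        using F(3) by (intro exI[of _ "max t (Suc s)"]) auto
    qed
    then obtain nxt where nxt: "\<And>s. nxt s > s" "\<And>s. \<exists>F\<subseteq>{s..<nxt s}. norm (sum x F) \<ge> e"
      by metis
    define m where "m k = (nxt ^^ k) 0" for k
    have m0: "m 0 = 0" and mSuc: "m (Suc k) = nxt (m k)" for k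
      by (simp_all add: m_def)
    have mono: "strict_mono m"
      by (simp add: strict_mono_Suc_iff mSuc nxt(1))
    have "\<exists>F p. norm (sum x F) \<ge> e \<and> F \<subseteq> {m k..<m (Suc k)} \<and>
        p permutes {m k..<m (Suc k)} \<and> p ` {m k..<m k + card F} = F" for k
    proof -
      obtain F where F: "F \<subseteq> {m k..<m (Suc k)}" "norm (sum x F) \<ge> e"
        using nxt(2)[of "m k"] by (auto simp: mSuc)
      then show ?thesis
        using permutes_interval_moving_set_to_front[OF F(1)] by metis
    qed
    then obtain F p where F: "\<And>k. norm (sum x (F k)) \<ge> e" "\<And>k. F k \<subseteq> {m k..<m (Suc k)}"
      and p: "\<And>k. p k permutes {m k..<m (Suc k)}" "\<And>k. p k ` {m k..<m k + card (F k)} = F k"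
      by metis
    obtain \<sigma> where \<sigma>: "bij \<sigma>" "\<And>k n. n \<in> {m k..<m (Suc k)} \<Longrightarrow> \<sigma> n = p k n"
      using bij_glue_interval_permutations[OF mono m0 p(1)] by metis
    have "summable (\<lambda>n. x (\<sigma> n))"
      using uc \<sigma>(1) by (simp add: unconditionally_convergent_def)
    then obtain N where N: "\<And>s t. s \<ge> N \<Longrightarrow> norm (\<Sum>n=s..<t. x (\<sigma> n)) < e"
      using e unfolding summable_Cauchy by meson
    let ?J = "{m N..<m N + card (F N)}"
    have "card (F N) \<le> m (Suc N) - m N"
      using card_mono[OF _ F(2)[of N]] by simp
    then have "?J \<subseteq> {m N..<m (Suc N)}"
      by (cases "card (F N) = 0") auto
    then have *: "\<sigma> n = p N n" if "n \<in> ?J" for n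
      using \<sigma>(2) that by blast
    then have "\<sigma> ` ?J = F N"
      using p(2)[of N] by (metis image_cong)
    moreover have "inj_on \<sigma> ?J"
      using \<sigma>(1) by (meson bij_is_inj inj_on_subset subset_UNIV)
    ultimately have "(\<Sum>n\<in>?J. x (\<sigma> n)) = sum x (F N)"
      using sum.reindex[of \<sigma> ?J x] by (simp add: o_def)
    with N[of "m N" "m N + card (F N)"] F(1)[of N] seq_suble[OF mono, of N] show False
      by simp
  qed
qed

text \<open>
  The family need not be absolutely summable, since only sums within a block are controlled. A
  finite set of indices that avoids the blocks of a finite set \<open>X\<close> meets every other block in a
  set with sum bounded by \<open>c k\<close>, and the Cauchy criterion for \<open>c\<close> makes the total small.
\<close>

lemma summable_on_blocks:
  fixes f :: "'i \<times> 'j \<Rightarrow> 'b::banach" and c :: "'i \<Rightarrow> real"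
  assumes fin: "\<And>k. finite (D k)" and supp: "\<And>k i. i \<notin> D k \<Longrightarrow> f (k, i) = 0"
    and bound: "\<And>k G. finite G \<Longrightarrow> norm (\<Sum>i\<in>G. f (k, i)) \<le> c k"
    and c: "c summable_on UNIV"
  shows "f summable_on UNIV"
  unfolding summable_on_iff_Cauchy
proof (intro allI impI)
  fix e :: real assume "e > 0"
  then obtain X where X: "finite X" "\<And>K. finite K \<Longrightarrow> K \<inter> X = {} \<Longrightarrow> norm (sum c K) < e"
    using c unfolding summable_on_iff_Cauchy by meson
  have "norm (sum f F) < e" if F: "finite F" "F \<inter> Sigma X D = {}" for F
  proof -
    define G where "G k = {i. (k, i) \<in> F}" for k
    have finG: "finite (G k)" for k
      using finite_vimageI[OF F(1), of "Pair k"] by (simp add: G_def vimage_def inj_on_def)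
    define K where "K = fst ` F - X"
    have "F = Sigma (fst ` F) G"
      by (force simp: G_def)
    then have "sum f F = (\<Sum>k\<in>fst ` F. \<Sum>i\<in>G k. f (k, i))"
      using F(1) finG by (subst sum.Sigma) (auto simp: case_prod_beta)
    also have "\<dots> = (\<Sum>k\<in>K. \<Sum>i\<in>G k. f (k, i))"
    proof (rule sum.mono_neutral_right)
      show "\<forall>k\<in>fst ` F - K. (\<Sum>i\<in>G k. f (k, i)) = 0"
        using F(2) supp by (auto simp: K_def G_def intro!: sum.neutral)
    qed (use F(1) in \<open>auto simp: K_def\<close>)
    also have "norm \<dots> \<le> sum c K"
      using bound finG by (intro sum_norm_le) auto
    also have "\<dots> < e"
    proof -
      have "finite K" "K \<inter> X = {}"
        using F(1) by (auto simp: K_def)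
      then have "\<bar>sum c K\<bar> < e"
        using X(2) by (metis real_norm_def)
      then show ?thesis
        by simp
    qed
    finally show ?thesis .
  qed
  then show "\<exists>X. finite X \<and> (\<forall>F. finite F \<longrightarrow> F \<inter> X = {} \<longrightarrow> norm (sum f F) < e)"
    using X(1) fin by (intro exI[of _ "Sigma X D"]) auto
qed

section \<open>Unconditional actions\<close>

lemma (in banach_action) act_zero_left [simp]: "act 0 x = 0"
  by (rule module_hom.zero[OF module_hom_linearI[OF linear_left]])

lemma (in banach_action) act_zero_right [simp]: "act a 0 = 0"
  by (rule module_hom.zero[OF module_hom_linearI[OF linear_right]])

lemma (in banach_action) act_scaleR: "act (r *\<^sub>R a) (s *\<^sub>R x) = (r * s) *\<^sub>R act a x"
proof -
  have "act (r *\<^sub>R a) y = r *\<^sub>R act a y" for y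
    using module_hom.scale[OF module_hom_linearI[OF linear_left], of "of_real r" a y]
    by (simp add: A.scale_of_real Y.scale_of_real)
  moreover have "act a (s *\<^sub>R x) = s *\<^sub>R act a x"
    using module_hom.scale[OF module_hom_linearI[OF linear_right], of a "of_real s" x]
    by (simp add: X.scale_of_real Y.scale_of_real)
  ultimately show ?thesis
    by simp
qed

text \<open>
  The defining inequality over \<open>{..<n}\<close> extends to every finite set of indices on replacing
  \<open>x k\<close> by 0 outside the set.
\<close>

lemma (in banach_action) unconditional_actionD:
  assumes "unconditional_action act"
  obtains C where "C > 0"
    "\<And>(F :: nat set) a x B d. finite F \<Longrightarrow> (\<And>k. norm (a k) \<le> B) \<Longrightarrow>
      (\<And>G. G \<subseteq> F \<Longrightarrow> norm (\<Sum>k\<in>G. x k) \<le> d) \<Longrightarrow>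
      norm (\<Sum>k\<in>F. act (a k) (x k)) \<le> C * B * d"
proof -
  obtain C where C: "C > 0" and ineq: "\<forall>n\<ge>1::nat. \<forall>a x. norm (\<Sum>k<n. act (a k) (x k))
      \<le> C * (MAX k\<in>{..<n}. norm (a k)) * (MAX F\<in>Pow {..<n}. norm (\<Sum>k\<in>F. x k))"
    using assms unfolding unconditional_action_def by (elim exE conjE) (rule that)
  have "norm (\<Sum>k\<in>F. act (a k) (x k)) \<le> C * B * d"
    if F: "finite F" and B: "\<And>k. norm (a k) \<le> B"
      and d: "\<And>G. G \<subseteq> F \<Longrightarrow> norm (\<Sum>k\<in>G. x k) \<le> d" for F :: "nat set" and a x B d
  proof -
    obtain t where t: "\<forall>k\<in>F. k < t"
      using F finite_nat_set_iff_bounded by blast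
    define n where "n = Suc t"
    define x' where "x' k = (if k \<in> F then x k else 0)" for k
    have sub: "F \<subseteq> {..<n}"
      using t by (auto simp: n_def)
    have "(\<Sum>k\<in>F. act (a k) (x k)) = (\<Sum>k<n. act (a k) (x' k))"
      using sub by (intro sum.mono_neutral_cong_left) (auto simp: x'_def)
    also have "norm \<dots> \<le> C * (MAX k\<in>{..<n}. norm (a k)) * (MAX G\<in>Pow {..<n}. norm (\<Sum>k\<in>G. x' k))"
      by (rule ineq[rule_format]) (simp add: n_def)
    also have "\<dots> \<le> C * B * d"
    proof (intro mult_mono mult_nonneg_nonneg order.refl)
      show "(MAX k\<in>{..<n}. norm (a k)) \<le> B"
        using B by (subst Max_le_iff) (auto simp: n_def)
      have "norm (\<Sum>k\<in>G. x' k) \<le> d" if "G \<subseteq> {..<n}" for G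
      proof -
        have "finite G"
          using that by (rule finite_subset) simp
        then have "(\<Sum>k\<in>G. x' k) = (\<Sum>k\<in>G \<inter> F. x k)"
          by (simp add: x'_def sum.inter_restrict)
        then show ?thesis
          using d by simp
      qed
      then show "(MAX G\<in>Pow {..<n}. norm (\<Sum>k\<in>G. x' k)) \<le> d"
        by (subst Max_le_iff) auto
      show "0 \<le> B"
        using B norm_ge_zero order_trans by blast
      show "0 \<le> (MAX k\<in>{..<n}. norm (a k))"
        by (subst Max_ge_iff) (auto simp: n_def)
      show "0 \<le> (MAX G\<in>Pow {..<n}. norm (\<Sum>k\<in>G. x' k))"
        by (subst Max_ge_iff) auto
    qed (use C in auto)
    finally show ?thesis .
  qed
  with C show thesis
    by (rule that)
qed

lemma (in banach_action) unconditional_imp_preserves: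
  assumes "unconditional_action act"
  shows "preserves_unconditional_convergence act"
  unfolding preserves_unconditional_convergence_def
proof (intro allI impI)
  fix x :: "nat \<Rightarrow> 'x" and a :: "nat \<Rightarrow> 'a"
  assume x: "unconditionally_convergent x" and "bounded (range a)"
  then obtain B where B: "B > 0" "\<And>k. norm (a k) \<le> B"
    by (auto simp: bounded_pos)
  obtain C where C: "C > 0"
    and ineq: "\<And>(F :: nat set) a x B d. finite F \<Longrightarrow> (\<And>k. norm (a k) \<le> B) \<Longrightarrow>
      (\<And>G. G \<subseteq> F \<Longrightarrow> norm (\<Sum>k\<in>G. x k) \<le> d) \<Longrightarrow>
      norm (\<Sum>k\<in>F. act (a k) (x k)) \<le> C * B * d"
    using unconditional_actionD[OF assms] by blast
  show "unconditionally_convergent (\<lambda>n. act (a n) (x n))"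
    unfolding unconditionally_convergent_iff_summable_on summable_on_iff_Cauchy
  proof (intro allI impI)
    fix e :: real assume e: "e > 0"
    define d where "d = e / (2 * C * B)"
    have "d > 0"
      using e B C by (simp add: d_def)
    then obtain X where X: "finite X" "\<And>F. finite F \<Longrightarrow> F \<inter> X = {} \<Longrightarrow> norm (sum x F) < d"
      using x unfolding unconditionally_convergent_iff_summable_on summable_on_iff_Cauchy by meson
    have "norm (\<Sum>k\<in>F. act (a k) (x k)) < e" if F: "finite F" "F \<inter> X = {}" for F
    proof -
      have "norm (\<Sum>k\<in>G. x k) \<le> d" if "G \<subseteq> F" for G
      proof -
        have "finite G" "G \<inter> X = {}"
          using F that finite_subset by auto
        then show ?thesis
          using X(2) less_imp_le by blast
      qed
      then have "norm (\<Sum>k\<in>F. act (a k) (x k)) \<le> C * B * d"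
        using F(1) B(2) by (intro ineq) auto
      also have "C * B * d = e / 2"
        using B C by (simp add: d_def)
      finally show ?thesis
        using e by simp
    qed
    with X(1) show "\<exists>X. finite X \<and>
        (\<forall>F. finite F \<longrightarrow> F \<inter> X = {} \<longrightarrow> norm (\<Sum>k\<in>F. act (a k) (x k)) < e)"
      by blast
  qed
qed

text \<open>
  A violation of the inequality for \<open>C\<close> stays one when the \<open>a\<close>'s and the \<open>x\<close>'s are rescaled. Both
  maxima are nonzero, as otherwise all the terms \<open>act (a k) (x k)\<close> vanish; so the first maximum
  can be normalised to 1 and the second one to \<open>1 / C\<close>.
\<close>

lemma (in banach_action) not_unconditional_action_block:
  assumes "\<not> unconditional_action act" and C: "C > 0"
  obtains n :: nat and a x where "\<And>k. k < n \<Longrightarrow> norm (a k) \<le> 1"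
    "\<And>G. G \<subseteq> {..<n} \<Longrightarrow> norm (\<Sum>k\<in>G. x k) \<le> 1 / C"
    "norm (\<Sum>k<n. act (a k) (x k)) \<ge> 1"
proof -
  have "\<not> (\<forall>n\<ge>1::nat. \<forall>a x. norm (\<Sum>k<n. act (a k) (x k))
      \<le> C * (MAX k\<in>{..<n}. norm (a k)) * (MAX F\<in>Pow {..<n}. norm (\<Sum>k\<in>F. x k)))"
  proof
    assume "\<forall>n\<ge>1::nat. \<forall>a x. norm (\<Sum>k<n. act (a k) (x k))
      \<le> C * (MAX k\<in>{..<n}. norm (a k)) * (MAX F\<in>Pow {..<n}. norm (\<Sum>k\<in>F. x k))"
    with C have "unconditional_action act"
      unfolding unconditional_action_def by (intro exI[of _ C] conjI)
    with assms(1) show False ..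
  qed
  then obtain n :: nat and a x where "n \<ge> 1" and viol: "norm (\<Sum>k<n. act (a k) (x k))
      > C * (MAX k\<in>{..<n}. norm (a k)) * (MAX F\<in>Pow {..<n}. norm (\<Sum>k\<in>F. x k))"
    unfolding not_all not_imp not_le by (elim exE conjE) (rule that)
  define A where "A = (MAX k\<in>{..<n}. norm (a k))"
  define M where "M = (MAX F\<in>Pow {..<n}. norm (\<Sum>k\<in>F. x k))"
  have A: "norm (a k) \<le> A" if "k < n" for k
    using that by (simp add: A_def)
  have M: "norm (\<Sum>k\<in>G. x k) \<le> M" if "G \<subseteq> {..<n}" for G
    using that unfolding M_def by (intro Max_ge) auto
  have "A \<ge> 0"
    using A[of 0] \<open>n \<ge> 1\<close> norm_ge_zero[of "a 0"] by linarith
  have "M \<ge> 0"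
    using M[of "{}"] by simp
  have viol: "norm (\<Sum>k<n. act (a k) (x k)) > C * A * M"
    using viol by (simp add: A_def M_def)
  moreover have "C * A * M \<ge> 0"
    using C \<open>A \<ge> 0\<close> \<open>M \<ge> 0\<close> by simp
  ultimately have "(\<Sum>k<n. act (a k) (x k)) \<noteq> 0"
    by auto
  then obtain j where j: "j < n" "act (a j) (x j) \<noteq> 0"
    by (meson lessThan_iff sum.neutral)
  then have "a j \<noteq> 0" "x j \<noteq> 0"
    by auto
  then have "0 < norm (a j)" "0 < norm (x j)"
    by simp_all
  moreover have "norm (a j) \<le> A" "norm (x j) \<le> M"
    using A[OF j(1)] M[of "{j}"] j(1) by simp_all
  ultimately have "A > 0" "M > 0"
    by linarith+
  define a' where "a' k = (1 / A) *\<^sub>R a k" for k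
  define x' where "x' k = (1 / (C * M)) *\<^sub>R x k" for k
  show thesis
  proof (rule that)
    show "norm (a' k) \<le> 1" if "k < n" for k
      using A[OF that] \<open>A > 0\<close> by (simp add: a'_def)
    show "norm (\<Sum>k\<in>G. x' k) \<le> 1 / C" if "G \<subseteq> {..<n}" for G
    proof -
      have "norm (\<Sum>k\<in>G. x' k) = norm (\<Sum>k\<in>G. x k) / (C * M)"
        using C \<open>M > 0\<close> by (simp add: x'_def abs_mult flip: scaleR_sum_right)
      also have "\<dots> \<le> M / (C * M)"
        using M[OF that] C \<open>M > 0\<close> by (intro divide_right_mono) auto
      finally show ?thesis
        using \<open>M > 0\<close> by simp
    qed
    have "(\<Sum>k<n. act (a' k) (x' k)) = (1 / (C * A * M)) *\<^sub>R (\<Sum>k<n. act (a k) (x k))"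
      by (simp add: a'_def x'_def act_scaleR scaleR_sum_right mult_ac)
    then have "norm (\<Sum>k<n. act (a' k) (x' k)) = norm (\<Sum>k<n. act (a k) (x k)) / (C * A * M)"
      using C \<open>A > 0\<close> \<open>M > 0\<close> by (simp add: abs_mult)
    then show "norm (\<Sum>k<n. act (a' k) (x' k)) \<ge> 1"
      using viol C \<open>A > 0\<close> \<open>M > 0\<close> by (simp add: pos_le_divide_eq)
  qed
qed

lemma (in banach_action) preserves_imp_unconditional:
  assumes pres: "preserves_unconditional_convergence act"
  shows "unconditional_action act"
proof (rule ccontr)
  assume not_unc: "\<not> unconditional_action act"
  have "\<exists>(n :: nat) a x. (\<forall>i<n. norm (a i) \<le> 1) \<and>
      (\<forall>G\<subseteq>{..<n}. norm (\<Sum>i\<in>G. x i) \<le> 1 / 2 ^ k) \<and>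
      norm (\<Sum>i<n. act (a i) (x i)) \<ge> 1" for k :: nat
  proof -
    have "(2 :: real) ^ k > 0"
      by simp
    then obtain n :: nat and a x where "\<And>i. i < n \<Longrightarrow> norm (a i) \<le> 1"
        "\<And>G. G \<subseteq> {..<n} \<Longrightarrow> norm (\<Sum>i\<in>G. x i) \<le> 1 / 2 ^ k"
        "norm (\<Sum>i<n. act (a i) (x i)) \<ge> 1"
      by (rule not_unconditional_action_block[OF not_unc]) (rule that)
    then show ?thesis
      by blast
  qed
  then obtain n :: "nat \<Rightarrow> nat" and a :: "nat \<Rightarrow> nat \<Rightarrow> 'a" and x :: "nat \<Rightarrow> nat \<Rightarrow> 'x"
    where a: "\<And>k i. i < n k \<Longrightarrow> norm (a k i) \<le> 1"
      and x: "\<And>k G. G \<subseteq> {..<n k} \<Longrightarrow> norm (\<Sum>i\<in>G. x k i) \<le> 1 / 2 ^ k"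
      and large: "\<And>k. norm (\<Sum>i<n k. act (a k i) (x k i)) \<ge> 1"
    by metis
  define u where "u = (\<lambda>(k, i). if i < n k then a k i else 0)"
  define v where "v = (\<lambda>(k, i). if i < n k then x k i else 0)"
  have v: "v summable_on UNIV"
  proof (rule summable_on_blocks)
    show "finite {..<n k}" for k
      by simp
    show "v (k, i) = 0" if "i \<notin> {..<n k}" for k i
      using that by (simp add: v_def)
    show "norm (\<Sum>i\<in>G. v (k, i)) \<le> (1 / 2) ^ k" if "finite G" for k G
    proof -
      have "(\<Sum>i\<in>G. v (k, i)) = (\<Sum>i\<in>G \<inter> {..<n k}. x k i)"
        using that by (simp add: v_def sum.inter_restrict)
      then show ?thesis
        using x[of "G \<inter> {..<n k}" k] by (simp add: power_one_over)
    qed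
    show "(\<lambda>k. (1 / 2 :: real) ^ k) summable_on UNIV"
      by (intro summable_nonneg_imp_summable_on summable_geometric) auto
  qed
  have "norm (u p) \<le> 1" for p
    using a by (auto simp: u_def split: prod.split)
  then have "bounded (range (\<lambda>j. u (prod_decode j)))"
    by (intro boundedI[where B=1]) (metis rangeE)
  moreover have "unconditionally_convergent (\<lambda>j. v (prod_decode j))"
    unfolding unconditionally_convergent_iff_summable_on
    using v by (simp add: summable_on_reindex_bij_betw[OF bij_prod_decode])
  ultimately have
    "unconditionally_convergent (\<lambda>j. act (u (prod_decode j)) (v (prod_decode j)))"
    using pres by (simp add: preserves_unconditional_convergence_def)
  then have "(\<lambda>p. act (u p) (v p)) summable_on UNIV"
    unfolding unconditionally_convergent_iff_summable_on
    using summable_on_reindex_bij_betw[OF bij_prod_decode, of "\<lambda>p. act (u p) (v p)"] by simp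
  then obtain X where X: "finite X"
    "\<And>F. finite F \<Longrightarrow> F \<inter> X = {} \<Longrightarrow> norm (\<Sum>p\<in>F. act (u p) (v p)) < 1"
    unfolding summable_on_iff_Cauchy by (meson zero_less_one)
  \<comment> \<open>A whole block disjoint from \<open>X\<close> violates the Cauchy criterion for the images.\<close>
  obtain k where k: "k \<notin> fst ` X"
    using X(1) ex_new_if_finite[OF infinite_UNIV_nat, of "fst ` X"] by auto
  have "(\<Sum>p\<in>{k} \<times> {..<n k}. act (u p) (v p)) = (\<Sum>i<n k. act (a k i) (x k i))"
    by (rule sum.reindex_bij_witness[of _ "Pair k" snd]) (auto simp: u_def v_def)
  moreover have "({k} \<times> {..<n k}) \<inter> X = {}"
    using k by force
  ultimately show False
    using X(2)[of "{k} \<times> {..<n k}"] large[of k] by simp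
qed

theorem theorem3p2:
  fixes scaleA :: "'f::real_normed_field \<Rightarrow> 'a::banach \<Rightarrow> 'a"
    and scaleX :: "'f \<Rightarrow> 'x::banach \<Rightarrow> 'x"
    and scaleY :: "'f \<Rightarrow> 'y::banach \<Rightarrow> 'y"
    and act :: "'a \<Rightarrow> 'x \<Rightarrow> 'y"
  assumes "banach_action scaleA scaleX scaleY act"
  shows "preserves_unconditional_convergence act \<longleftrightarrow> unconditional_action act"
  using banach_action.preserves_imp_unconditional[OF assms]
    banach_action.unconditional_imp_preserves[OF assms] by blast

end
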